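(* There is a $\frac{1}{2(k_{in}+k_{out}+1)}$-approximation algorithm for unweighted stochastic probing with deadlines when $\mathcal{I}_{in}$ is a $k_{in}$-system and $\mathcal{I}_{out}$ is a $k_{out}$-system; i.e., a polynomial-time policy whose expected number of chosen elements is at least $\frac{1}{2(k_{in}+k_{out}+1)}$ times that of an optimal policy.
   Context: Unweighted stochastic probing with deadlines: $V$ is a finite universe; each $e\in V$ has a probability $p_e\in[0,1]$, is active independently with probability $p_e$, and has a positive integer deadline $d_e$. $\mathcal{I}_{in},\mathcal{I}_{out}\subseteq 2^V$ are downward-closed. A policy probes elements one at a time; each probe takes one unit of time, the $t$-th probe occurring at time $t$ (starting at $t=1$), and element $e$ may be probed at time $t$ only if $t\le d_e$. With $Q$ the probed set and $S$ the chosen set so far (initially empty), the policy may probe $e\notin Q$ only if $Q\cup\{e\}\in\mathcal{I}_{out}$ and $S\cup\{e\}\in\mathcal{I}_{in}$; then $e$ is added to $Q$, and irrevocably to $S$ if active. The objective is to maximize $\mathbb{E}[|S|]$. A $k$-system is a downward-closed $\mathcal{I}\subseteq 2^V$ such that for every $A\subseteq V$, every maximal independent subset of $A$ has size at least $\frac1k$ of a maximum independent subset of $A$. *)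

theory Defs
  imports "HOL-Probability.Probability" "HOL-Library.Log_Nat"
    "HOL-Computational_Algebra.Polynomial"
begin

section \<open>Independence systems\<close>

definition downward_closed :: "'a set \<Rightarrow> 'a set set \<Rightarrow> bool" where
  "downward_closed V \<I> \<longleftrightarrow> \<I> \<subseteq> Pow V \<and> (\<forall>A\<in>\<I>. \<forall>B\<subseteq>A. B \<in> \<I>)"

definition maximal_indep :: "'a set set \<Rightarrow> 'a set \<Rightarrow> 'a set \<Rightarrow> bool" where
  "maximal_indep \<I> A B \<longleftrightarrow> B \<subseteq> A \<and> B \<in> \<I> \<and> (\<forall>C. B \<subseteq> C \<and> C \<subseteq> A \<and> C \<in> \<I> \<longrightarrow> C = B)"

definition maximum_indep :: "'a set set \<Rightarrow> 'a set \<Rightarrow> 'a set \<Rightarrow> bool" where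
  "maximum_indep \<I> A M \<longleftrightarrow> M \<subseteq> A \<and> M \<in> \<I> \<and> (\<forall>C. C \<subseteq> A \<and> C \<in> \<I> \<longrightarrow> card C \<le> card M)"

definition k_system :: "real \<Rightarrow> 'a set \<Rightarrow> 'a set set \<Rightarrow> bool" where
  "k_system k V \<I> \<longleftrightarrow> 0 < k \<and> downward_closed V \<I> \<and>
     (\<forall>A\<subseteq>V. \<forall>B M. maximal_indep \<I> A B \<and> maximum_indep \<I> A M
        \<longrightarrow> real (card B) \<ge> 1 / k * real (card M))"


section \<open>Stochastic probing with deadlines\<close>

text \<open>The universe is \<open>{..<n}\<close>, so that one program can be run on all instances.\<close>

record probing_instance =
  n_elems :: nat
  act_prob :: "nat \<Rightarrow> real"
  deadline :: "nat \<Rightarrow> nat"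
  inner :: "nat set set"
  outer :: "nat set set"

definition universe :: "probing_instance \<Rightarrow> nat set" where
  "universe I = {..<n_elems I}"

definition valid_instance :: "probing_instance \<Rightarrow> bool" where
  "valid_instance I \<longleftrightarrow>
     (\<forall>e\<in>universe I. 0 \<le> act_prob I e \<and> act_prob I e \<le> 1 \<and> 1 \<le> deadline I e) \<and>
     downward_closed (universe I) (inner I) \<and> downward_closed (universe I) (outer I)"

text \<open>A history lists the probed elements in order, each with the outcome of its probe
  (\<open>True\<close> for active). A policy maps the history to the next element to be probed;
  \<open>None\<close> means that it stops.\<close>

type_synonym history = "(nat \<times> bool) list"

type_synonym policy = "history \<Rightarrow> nat option"

definition probed :: "history \<Rightarrow> nat set" where
  "probed h = fst ` set h"

definition chosen :: "history \<Rightarrow> nat set" where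
  "chosen h = {e. (e, True) \<in> set h}"

definition may_probe :: "probing_instance \<Rightarrow> history \<Rightarrow> nat \<Rightarrow> bool" where
  "may_probe I h e \<longleftrightarrow> e \<in> universe I \<and> e \<notin> probed h \<and>
     insert e (probed h) \<in> outer I \<and> insert e (chosen h) \<in> inner I \<and>
     length h + 1 \<le> deadline I e"

text \<open>In the following, \<open>\<omega> e\<close> tells whether element \<open>e\<close> is active.\<close>

fun run_policy :: "policy \<Rightarrow> (nat \<Rightarrow> bool) \<Rightarrow> nat \<Rightarrow> history" where
  "run_policy \<pi> \<omega> 0 = []"
| "run_policy \<pi> \<omega> (Suc t) =
     (let h = run_policy \<pi> \<omega> t in
      case \<pi> h of None \<Rightarrow> h | Some e \<Rightarrow> h @ [(e, \<omega> e)])"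

definition feasible_policy :: "probing_instance \<Rightarrow> policy \<Rightarrow> bool" where
  "feasible_policy I \<pi> \<longleftrightarrow>
     (\<forall>\<omega> t e. \<pi> (run_policy \<pi> \<omega> t) = Some e \<longrightarrow> may_probe I (run_policy \<pi> \<omega> t) e)"

text \<open>A feasible policy never probes an element twice and hence has stopped
  after at most \<open>n_elems I\<close> probes.\<close>

definition final_history :: "probing_instance \<Rightarrow> policy \<Rightarrow> (nat \<Rightarrow> bool) \<Rightarrow> history" where
  "final_history I \<pi> \<omega> = run_policy \<pi> \<omega> (n_elems I)"

definition activity :: "probing_instance \<Rightarrow> (nat \<Rightarrow> bool) pmf" where
  "activity I = Pi_pmf (universe I) False (\<lambda>e. bernoulli_pmf (act_prob I e))"

definition expected_chosen :: "probing_instance \<Rightarrow> policy \<Rightarrow> real" where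
  "expected_chosen I \<pi> =
     measure_pmf.expectation (activity I) (\<lambda>\<omega>. real (card (chosen (final_history I \<pi> \<omega>))))"


section \<open>Probing programs and their running time\<close>

text \<open>Programs for a random access machine with a memory of naturals and a memory of
  reals (both indirectly addressable), random access to the input numbers, membership
  oracles for the two set families, and a probe command. Every atomic command and
  every test costs one time unit. There is no multiplication, as repeated squaring
  would produce numbers of exponential bit length at unit cost. A run of length \<open>T\<close> only
  yields numbers that are integer combinations of the input numbers and constants, with
  coefficients of \<open>O(T)\<close> bits; for rational probabilities a Turing machine
  with the same oracles simulates it in time polynomial in \<open>T\<close> and the bit length of
  the input.\<close>

datatype aexp =
    Const nat
  | NumElems
  | Deadline aexp
  | Cell aexp
  | Plus aexp aexp
  | Minus aexp aexp

datatype rexp =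
    OfNat aexp
  | ActProb aexp
  | RCell aexp
  | RPlus rexp rexp
  | RMinus rexp rexp

text \<open>The query \<open>InInner a\<close> asks whether the set with the characteristic vector stored
  in the \<open>n\<close> natural cells starting at address \<open>a\<close> belongs to the inner family.\<close>

datatype bexp =
    Less aexp aexp
  | RLess rexp rexp
  | InInner aexp
  | InOuter aexp
  | Neg bexp
  | Conj bexp bexp

text \<open>\<open>Probe a b\<close> probes element \<open>b\<close> and writes the outcome (1 for active, 0 for inactive)
  to the natural cell \<open>a\<close>.\<close>

datatype com =
    Skip
  | Assign aexp aexp
  | RAssign aexp rexp
  | Probe aexp aexp
  | Seq com com
  | If bexp com com
  | While bexp com

record state =
  cells :: "nat \<Rightarrow> nat"
  rcells :: "nat \<Rightarrow> real"
  probes :: history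

definition initial_state :: state where
  "initial_state = \<lparr>cells = (\<lambda>_. 0), rcells = (\<lambda>_. 0), probes = []\<rparr>"

fun aval :: "probing_instance \<Rightarrow> state \<Rightarrow> aexp \<Rightarrow> nat" where
  "aval I s (Const k) = k"
| "aval I s NumElems = n_elems I"
| "aval I s (Deadline a) = (let e = aval I s a in if e \<in> universe I then deadline I e else 0)"
| "aval I s (Cell a) = cells s (aval I s a)"
| "aval I s (Plus a b) = aval I s a + aval I s b"
| "aval I s (Minus a b) = aval I s a - aval I s b"

fun rval :: "probing_instance \<Rightarrow> state \<Rightarrow> rexp \<Rightarrow> real" where
  "rval I s (OfNat a) = real (aval I s a)"
| "rval I s (ActProb a) = (let e = aval I s a in if e \<in> universe I then act_prob I e else 0)"
| "rval I s (RCell a) = rcells s (aval I s a)"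
| "rval I s (RPlus x y) = rval I s x + rval I s y"
| "rval I s (RMinus x y) = rval I s x - rval I s y"

definition stored_set :: "probing_instance \<Rightarrow> state \<Rightarrow> nat \<Rightarrow> nat set" where
  "stored_set I s a = {e \<in> universe I. cells s (a + e) \<noteq> 0}"

fun bval :: "probing_instance \<Rightarrow> state \<Rightarrow> bexp \<Rightarrow> bool" where
  "bval I s (Less a b) \<longleftrightarrow> aval I s a < aval I s b"
| "bval I s (RLess x y) \<longleftrightarrow> rval I s x < rval I s y"
| "bval I s (InInner a) \<longleftrightarrow> stored_set I s (aval I s a) \<in> inner I"
| "bval I s (InOuter a) \<longleftrightarrow> stored_set I s (aval I s a) \<in> outer I"
| "bval I s (Neg b) \<longleftrightarrow> \<not> bval I s b"
| "bval I s (Conj b c) \<longleftrightarrow> bval I s b \<and> bval I s c"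

text \<open>\<open>exec I \<omega> c s T s'\<close>: started in state \<open>s\<close>, program \<open>c\<close> halts after \<open>T\<close> time units in
  state \<open>s'\<close>. The outcomes \<open>\<omega>\<close> are only accessible through \<open>Probe\<close>.\<close>

inductive exec ::
  "probing_instance \<Rightarrow> (nat \<Rightarrow> bool) \<Rightarrow> com \<Rightarrow> state \<Rightarrow> nat \<Rightarrow> state \<Rightarrow> bool"
  for I :: probing_instance and \<omega> :: "nat \<Rightarrow> bool" where
  Skip: "exec I \<omega> Skip s 1 s"
| Assign: "exec I \<omega> (Assign a b) s 1
     (s\<lparr>cells := (cells s)(aval I s a := aval I s b)\<rparr>)"
| RAssign: "exec I \<omega> (RAssign a x) s 1
     (s\<lparr>rcells := (rcells s)(aval I s a := rval I s x)\<rparr>)"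
| Probe: "e = aval I s b \<Longrightarrow>
     exec I \<omega> (Probe a b) s 1
     (s\<lparr>cells := (cells s)(aval I s a := of_bool (\<omega> e)), probes := probes s @ [(e, \<omega> e)]\<rparr>)"
| Seq: "exec I \<omega> c1 s T1 s1 \<Longrightarrow> exec I \<omega> c2 s1 T2 s2 \<Longrightarrow>
     exec I \<omega> (Seq c1 c2) s (T1 + T2) s2"
| IfTrue: "bval I s b \<Longrightarrow> exec I \<omega> c1 s T s' \<Longrightarrow> exec I \<omega> (If b c1 c2) s (1 + T) s'"
| IfFalse: "\<not> bval I s b \<Longrightarrow> exec I \<omega> c2 s T s' \<Longrightarrow> exec I \<omega> (If b c1 c2) s (1 + T) s'"
| WhileFalse: "\<not> bval I s b \<Longrightarrow> exec I \<omega> (While b c) s 1 s"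
| WhileTrue: "bval I s b \<Longrightarrow> exec I \<omega> c s T1 s1 \<Longrightarrow> exec I \<omega> (While b c) s1 T2 s2 \<Longrightarrow>
     exec I \<omega> (While b c) s (1 + T1 + T2) s2"

definition implements_within :: "com \<Rightarrow> probing_instance \<Rightarrow> policy \<Rightarrow> nat \<Rightarrow> bool" where
  "implements_within c I \<pi> B \<longleftrightarrow>
     (\<forall>\<omega>. \<exists>T s. exec I \<omega> c initial_state T s \<and> T \<le> B \<and> probes s = final_history I \<pi> \<omega>)"

text \<open>Deadlines count with their binary length; real input numbers count as one unit.\<close>

definition input_size :: "probing_instance \<Rightarrow> nat" where
  "input_size I = n_elems I + (\<Sum>e\<in>universe I. floorlog 2 (deadline I e))"

end

theory Submission
  imports Defs
begin

text \<open>Greedily probe, among the elements that may be probed, one of maximal activation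
  probability. Fix the outcomes, let \<open>Q\<close> and \<open>S\<close> be the probed and chosen sets of the greedy
  policy and \<open>Q'\<close> and \<open>S'\<close> those of another policy, and let \<open>T\<close> consist of the \<open>e \<in> Q'\<close> with
  \<open>e \<in> Q\<close> or \<open>insert e S\<close> independent in the inner system. Nothing of \<open>S' - T\<close> can be added to
  \<open>S\<close>, so \<open>card (S' - T) \<le> k_in * card S\<close>. An element of \<open>T\<close> that is more probable than the
  \<open>(i+1)\<close>-st greedy probe is among the first \<open>i\<close> probed elements, or was then blocked by the
  outer system or by its deadline; there are at most \<open>k_out * i\<close> of the outer kind (counting the
  already probed ones) and at most \<open>i\<close> with deadline at most \<open>i\<close>. Summation by parts
  turns these level counts into \<open>p(T) \<le> (k_out + 1) * p(Q)\<close>. Since \<open>e \<in> T\<close> does not depend on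
  the outcome of \<open>e\<close>, the expected number of active elements of \<open>T\<close> is the expectation of
  \<open>p(T)\<close>, and likewise \<open>E(card S) = E(p(Q))\<close>. So greedy is even within a factor
  \<open>k_in + k_out + 1\<close> of the optimum.\<close>

section \<open>Histories\<close>

lemma probed_simps [simp]:
  "probed [] = {}" "probed (h @ [(e, b)]) = insert e (probed h)"
  by (auto simp: probed_def)

lemma chosen_simps [simp]:
  "chosen [] = {}" "chosen (h @ [(e, b)]) = (if b then insert e (chosen h) else chosen h)"
  by (auto simp: chosen_def)

lemma chosen_subset_probed: "chosen h \<subseteq> probed h"
  by (force simp: chosen_def probed_def)

lemma finite_probed [simp]: "finite (probed h)"
  by (simp add: probed_def)

lemma finite_chosen [simp]: "finite (chosen h)"
  by (rule finite_subset[OF chosen_subset_probed]) simp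

lemma card_probed_le: "card (probed h) \<le> length h"
  unfolding probed_def by (metis card_image_le card_length finite_set le_trans)

lemma finite_universe [simp]: "finite (universe I)"
  by (simp add: universe_def)

lemma inner_subset: "valid_instance I \<Longrightarrow> A \<in> inner I \<Longrightarrow> B \<subseteq> A \<Longrightarrow> B \<in> inner I"
  by (auto simp: valid_instance_def downward_closed_def)

lemma outer_subset: "valid_instance I \<Longrightarrow> A \<in> outer I \<Longrightarrow> B \<subseteq> A \<Longrightarrow> B \<in> outer I"
  by (auto simp: valid_instance_def downward_closed_def)

text \<open>Forgets policy and outcomes: what depends only on the legality of each probe is proved
  by induction and passes to prefixes.\<close>

inductive feasible_history :: "probing_instance \<Rightarrow> history \<Rightarrow> bool" for I where
  Nil: "feasible_history I []"
| snoc: "feasible_history I h \<Longrightarrow> may_probe I h e \<Longrightarrow> feasible_history I (h @ [(e, b)])"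

lemma feasible_run:
  assumes "feasible_policy I \<pi>"
  shows "feasible_history I (run_policy \<pi> \<omega> t)"
proof (induction t)
  case (Suc t)
  then show ?case
    using assms by (auto simp: Let_def feasible_policy_def split: option.split intro: feasible_history.intros)
qed (simp add: feasible_history.Nil)

lemma feasible_history_probed_subset: "feasible_history I h \<Longrightarrow> probed h \<subseteq> universe I"
  by (induction rule: feasible_history.induct) (auto simp: may_probe_def)

lemma feasible_history_card_probed: "feasible_history I h \<Longrightarrow> card (probed h) = length h"
  by (induction rule: feasible_history.induct) (auto simp: may_probe_def)

lemma feasible_history_outer: "feasible_history I h \<Longrightarrow> {} \<in> outer I \<Longrightarrow> probed h \<in> outer I"
  by (induction rule: feasible_history.induct) (auto simp: may_probe_def)

text \<open>\<open>downward_closed\<close> admits the empty family; a legal probe exhibits a member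
  of \<open>outer I\<close>, whose subsets then belong to it as well.\<close>

lemma feasible_history_outer_empty:
  "feasible_history I h \<Longrightarrow> valid_instance I \<Longrightarrow> h \<noteq> [] \<Longrightarrow> {} \<in> outer I"
  by (induction rule: feasible_history.induct)
    (auto simp: may_probe_def valid_instance_def downward_closed_def)

lemma feasible_history_inner:
  "feasible_history I h \<Longrightarrow> valid_instance I \<Longrightarrow> {} \<in> inner I \<Longrightarrow> chosen h \<in> inner I"
  by (induction rule: feasible_history.induct) (auto simp: may_probe_def)

lemma feasible_history_inner_empty:
  "feasible_history I h \<Longrightarrow> valid_instance I \<Longrightarrow> h \<noteq> [] \<Longrightarrow> {} \<in> inner I"
  by (induction rule: feasible_history.induct)
    (auto simp: may_probe_def valid_instance_def downward_closed_def)

text \<open>The probe after a history \<open>h\<close> happens at time \<open>length h + 1\<close>,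
  so an element with deadline at most \<open>i\<close> cannot come later than position
  \<open>i\<close>.\<close>

lemma feasible_history_early_deadlines:
  "feasible_history I h \<Longrightarrow> {e \<in> probed h. deadline I e \<le> i} \<subseteq> probed (take i h)"
proof (induction rule: feasible_history.induct)
  case (snoc h e b)
  then show ?case
    by (cases "length h < i") (auto simp: may_probe_def not_less)
qed simp

lemma feasible_history_card_early_deadlines:
  assumes "feasible_history I h"
  shows "card {e \<in> probed h. deadline I e \<le> i} \<le> i"
proof -
  have "card {e \<in> probed h. deadline I e \<le> i} \<le> card (probed (take i h))"
    by (intro card_mono feasible_history_early_deadlines assms finite_probed)
  also have "\<dots> \<le> i"
    using card_probed_le[of "take i h"] by simp
  finally show ?thesis .
qed

lemma feasible_history_take: "feasible_history I h \<Longrightarrow> feasible_history I (take j h)"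
proof (induction rule: feasible_history.induct)
  case (snoc h e b)
  then show ?case
    by (cases "j \<le> length h") (auto intro: feasible_history.intros)
qed (simp add: feasible_history.Nil)

section \<open>Prefixes of a history\<close>

lemma probed_take_mono: "i \<le> j \<Longrightarrow> probed (take i h) \<subseteq> probed (take j h)"
  unfolding probed_def by (intro image_mono set_take_subset_set_take)

lemma chosen_take_mono: "i \<le> j \<Longrightarrow> chosen (take i h) \<subseteq> chosen (take j h)"
  unfolding chosen_def using set_take_subset_set_take[of i j h] by auto

text \<open>No condition in \<open>may_probe\<close> relaxes as the history grows.\<close>

lemma may_probe_take_antimono:
  assumes "valid_instance I" "i \<le> j" "may_probe I (take j h) e" "j \<le> length h"
  shows "may_probe I (take i h) e"
proof -
  have "insert e (probed (take i h)) \<subseteq> insert e (probed (take j h))"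
    "insert e (chosen (take i h)) \<subseteq> insert e (chosen (take j h))"
    using probed_take_mono[OF assms(2)] chosen_take_mono[OF assms(2)] by auto
  then have "insert e (probed (take i h)) \<in> outer I" "insert e (chosen (take i h)) \<in> inner I"
    using assms(3) inner_subset[OF assms(1)] outer_subset[OF assms(1)] unfolding may_probe_def by blast+
  then show ?thesis
    using assms probed_take_mono[OF assms(2), of h] unfolding may_probe_def by auto
qed

lemma run_policy_nth:
  "j < length (run_policy \<pi> \<omega> t) \<Longrightarrow>
     \<pi> (take j (run_policy \<pi> \<omega> t)) = Some (fst (run_policy \<pi> \<omega> t ! j))"
proof (induction t)
  case (Suc t)
  then show ?case
    by (cases "j < length (run_policy \<pi> \<omega> t)")
      (auto simp: Let_def nth_append less_Suc_eq split: option.splits)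
qed simp

text \<open>A stopped run keeps its history, on which the policy again answers \<open>None\<close>;
  a policy that still wants to probe has probed in every step.\<close>

lemma length_run_policy:
  "\<pi> (run_policy \<pi> \<omega> t) \<noteq> None \<Longrightarrow> length (run_policy \<pi> \<omega> t) = t"
  by (induction t) (auto simp: Let_def split: option.splits)

lemma policy_final_history:
  assumes "feasible_policy I \<pi>"
  shows "\<pi> (final_history I \<pi> \<omega>) = None"
proof (rule ccontr)
  let ?h = "run_policy \<pi> \<omega> (n_elems I)"
  assume "\<pi> (final_history I \<pi> \<omega>) \<noteq> None"
  then obtain e where e: "\<pi> ?h = Some e"
    by (auto simp: final_history_def)
  have "feasible_history I ?h"
    by (rule feasible_run[OF assms])
  then have "card (probed ?h) = card (universe I)" "probed ?h \<subseteq> universe I"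
    using feasible_history_card_probed feasible_history_probed_subset
      length_run_policy[of \<pi> \<omega> "n_elems I"] e by (auto simp: universe_def)
  then have "probed ?h = universe I"
    by (simp add: card_subset_eq)
  moreover have "may_probe I ?h e"
    using assms e by (simp add: feasible_policy_def)
  ultimately show False
    by (auto simp: may_probe_def)
qed

section \<open>Dependence of a run on the outcomes\<close>

lemma chosen_run_policy: "chosen (run_policy \<pi> \<omega> t) = {e \<in> probed (run_policy \<pi> \<omega> t). \<omega> e}"
  by (induction t) (auto simp: Let_def split: option.split)

lemma run_policy_upd:
  "e \<notin> probed (run_policy \<pi> \<omega> t) \<Longrightarrow> run_policy \<pi> (\<omega> (e := b)) t = run_policy \<pi> \<omega> t"
  by (induction t) (auto simp: Let_def split: option.splits)

text \<open>Whether to probe \<open>e\<close> is decided before its outcome is seen.\<close>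

lemma probed_run_policy_upd:
  "e \<in> probed (run_policy \<pi> (\<omega> (e := b)) t) \<longleftrightarrow> e \<in> probed (run_policy \<pi> \<omega> t)"
proof (cases "e \<in> probed (run_policy \<pi> \<omega> t)")
  case True
  have "e \<in> probed (run_policy \<pi> (\<omega> (e := b)) t)"
  proof (rule ccontr)
    assume new: "e \<notin> probed (run_policy \<pi> (\<omega> (e := b)) t)"
    \<comment> \<open>\<open>run_policy_upd\<close> is used backwards: resetting \<open>e\<close> to
      \<open>\<omega> e\<close> turns the updated outcomes back into
      \<open>\<omega>\<close>.\<close>
    then have "run_policy \<pi> \<omega> t = run_policy \<pi> (\<omega> (e := b)) t"
      using run_policy_upd[of e \<pi> "\<omega> (e := b)" t "\<omega> e"] by simp
    then show False
      using True new by simp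
  qed
  then show ?thesis
    using True by simp
qed (simp add: run_policy_upd)


section \<open>Expectations over activities\<close>

lemma finite_set_pmf_activity [simp]: "finite (set_pmf (activity I))"
proof -
  have "finite (PiE_dflt (universe I) False (\<lambda>_. UNIV :: bool set))"
    by (intro finite_PiE_dflt) auto
  moreover have "set_pmf (activity I) \<subseteq> PiE_dflt (universe I) False (\<lambda>_. UNIV)"
    by (auto simp: activity_def set_Pi_pmf PiE_dflt_def)
  ultimately show ?thesis
    using finite_subset by blast
qed

lemma integrable_activity [simp]: "integrable (measure_pmf (activity I)) (f :: _ \<Rightarrow> real)"
  by (rule integrable_measure_pmf_finite) simp

text \<open>The product distribution splits into the coin \<open>B\<close> of \<open>e\<close> and
  the rest \<open>R\<close>, and \<open>E\<close> conditions on the coin. It does not influence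
  \<open>f\<close>, and \<open>of_bool\<close> keeps only the active branch.\<close>

lemma expectation_activity_indep:
  fixes f :: "(nat \<Rightarrow> bool) \<Rightarrow> real"
  assumes e: "e \<in> universe I" and p: "0 \<le> act_prob I e" "act_prob I e \<le> 1"
    and f: "\<And>\<omega> b. f (\<omega> (e := b)) = f \<omega>"
  shows "measure_pmf.expectation (activity I) (\<lambda>\<omega>. f \<omega> * of_bool (\<omega> e)) =
    act_prob I e * measure_pmf.expectation (activity I) f"
proof -
  define R where "R = Pi_pmf (universe I - {e}) False (\<lambda>e. bernoulli_pmf (act_prob I e))"
  define B where "B = bernoulli_pmf (act_prob I e)"
  have U: "universe I = insert e (universe I - {e})"
    using e by auto
  have act: "activity I = map_pmf (\<lambda>(b, \<omega>). \<omega> (e := b)) (pair_pmf B R)"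
    unfolding activity_def R_def B_def
    by (subst U, subst Pi_pmf_insert) auto
  have fin: "finite (set_pmf R)"
    unfolding R_def by (subst set_Pi_pmf) (auto intro!: finite_PiE_dflt)
  have E: "measure_pmf.expectation (activity I) g =
      act_prob I e * measure_pmf.expectation R (\<lambda>\<omega>. g (\<omega> (e := True))) +
      (1 - act_prob I e) * measure_pmf.expectation R (\<lambda>\<omega>. g (\<omega> (e := False)))"
    for g :: "(nat \<Rightarrow> bool) \<Rightarrow> real"
  proof -
    have "activity I = B \<bind> (\<lambda>b. map_pmf (\<lambda>\<omega>. \<omega> (e := b)) R)"
      unfolding act pair_pmf_def map_pmf_def by (simp add: bind_assoc_pmf bind_return_pmf)
    then have "measure_pmf.expectation (activity I) g =
        measure_pmf.expectation B (\<lambda>b. measure_pmf.expectation R (\<lambda>\<omega>. g (\<omega> (e := b))))"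
      using fin by (simp add: pmf_expectation_bind[of UNIV] integral_measure_pmf_real[of UNIV] mult.commute)
    then show ?thesis
      using p by (simp add: B_def)
  qed
  show ?thesis
    unfolding E by (simp add: f algebra_simps)
qed


section \<open>Independence systems and sums with dominated level sets\<close>

text \<open>The definition is applied to the ground set \<open>B \<union> C\<close>: there
  \<open>B\<close> is maximal, as nothing of \<open>C - B\<close> can be added, and \<open>C\<close>
  is no larger than a maximum member.\<close>

lemma k_system_card_le:
  assumes k: "k_system k V \<I>" and V: "finite V" and B: "B \<in> \<I>" and C: "C \<in> \<I>"
    and blocked: "\<And>e. e \<in> C - B \<Longrightarrow> insert e B \<notin> \<I>"
  shows "real (card C) \<le> k * real (card B)"
proof -
  from k have dc: "downward_closed V \<I>" and "0 < k"
    by (auto simp: k_system_def)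
  then have sub: "B \<subseteq> V" "C \<subseteq> V"
    using B C by (auto simp: downward_closed_def)
  let ?A = "B \<union> C"
  have "\<forall>D. D \<subseteq> ?A \<and> D \<in> \<I> \<longrightarrow> card D \<le> card ?A"
    using finite_subset[OF _ V] sub by (simp add: card_mono)
  then obtain M where M: "M \<subseteq> ?A \<and> M \<in> \<I>" "\<And>D. D \<subseteq> ?A \<and> D \<in> \<I> \<Longrightarrow> card D \<le> card M"
    using ex_has_greatest_nat[of "\<lambda>D. D \<subseteq> ?A \<and> D \<in> \<I>" C card "Suc (card ?A)"] C
    by (auto simp: less_Suc_eq_le)
  then have "maximum_indep \<I> ?A M"
    by (simp add: maximum_indep_def)
  moreover have "maximal_indep \<I> ?A B"
    unfolding maximal_indep_def
  proof (intro conjI allI impI)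
    fix D
    assume D: "B \<subseteq> D \<and> D \<subseteq> ?A \<and> D \<in> \<I>"
    show "D = B"
    proof (rule ccontr)
      assume "D \<noteq> B"
      then obtain e where "e \<in> D" "e \<notin> B" "e \<in> C"
        using D by blast
      moreover from this have "insert e B \<in> \<I>"
        using D dc unfolding downward_closed_def by (meson insert_subset)
      ultimately show False
        using blocked by blast
    qed
  qed (use B in auto)
  moreover have "B \<union> C \<subseteq> V"
    using sub by simp
  ultimately have "real (card B) \<ge> 1 / k * real (card M)"
    using k unfolding k_system_def by blast
  then have "real (card M) \<le> k * real (card B)"
    using \<open>0 < k\<close> by (simp add: field_simps)
  moreover have "card C \<le> card M"
    using M C by simp
  ultimately show ?thesis
    by linarith
qed

text \<open>Bounding \<open>p e\<close> by the drops \<open>q i - q (Suc i)\<close> of the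
  thresholds below it replaces weights by level counts, which are then summed by parts.\<close>

lemma sum_le_of_level_counts:
  fixes p :: "'a \<Rightarrow> real" and q :: "nat \<Rightarrow> real"
  assumes "finite T" and q: "\<And>i. i < m \<Longrightarrow> q (Suc i) \<le> q i" and "q m = 0" and "0 \<le> K"
    and count: "\<And>i. i \<le> m \<Longrightarrow> real (card {e \<in> T. q i < p e}) \<le> K * real i"
  shows "sum p T \<le> K * (\<Sum>i<m. q i)"
proof -
  have p0: "p e \<le> q 0" if "e \<in> T" for e
  proof -
    have "{e \<in> T. q 0 < p e} = {}"
      using count[of 0] \<open>finite T\<close> by simp
    then show ?thesis
      using that by force
  qed
  \<comment> \<open>If \<open>p e\<close> exceeds \<open>q (Suc j)\<close>, the new drop offsets the
    lowered threshold; otherwise \<open>q (Suc j)\<close> alone suffices.\<close>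
  have layers: "p e \<le> q j + (\<Sum>i<j. (q i - q (Suc i)) * of_bool (q (Suc i) < p e))"
    if "e \<in> T" "j \<le> m" for e j
    using that(2)
  proof (induction j)
    case (Suc j)
    have "0 \<le> (\<Sum>i<j. (q i - q (Suc i)) * of_bool (q (Suc i) < p e))"
      using Suc.prems q by (intro sum_nonneg) auto
    then show ?case
      using Suc q[of j] by (cases "q (Suc j) < p e") auto
  qed (use p0 that in auto)
  \<comment> \<open>Abel summation; the boundary term vanishes at \<open>j = m\<close>.\<close>
  have abel: "(\<Sum>i<j. (q i - q (Suc i)) * real (Suc i)) = (\<Sum>i<j. q i) - real j * q j" for j
    by (induction j) (simp_all add: algebra_simps)
  have "sum p T \<le> (\<Sum>e\<in>T. \<Sum>i<m. (q i - q (Suc i)) * of_bool (q (Suc i) < p e))"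
    using layers[of _ m] \<open>q m = 0\<close> by (intro sum_mono) auto
  also have "\<dots> = (\<Sum>i<m. (q i - q (Suc i)) * real (card {e \<in> T. q (Suc i) < p e}))"
  proof (subst sum.swap, rule sum.cong)
    fix i
    have "(\<Sum>e\<in>T. of_bool (q (Suc i) < p e)) = real (card {e \<in> T. q (Suc i) < p e})"
      using \<open>finite T\<close> by (simp add: Int_def)
    then show "(\<Sum>e\<in>T. (q i - q (Suc i)) * of_bool (q (Suc i) < p e)) =
        (q i - q (Suc i)) * real (card {e \<in> T. q (Suc i) < p e})"
      by (simp only: sum_distrib_left[symmetric])
  qed simp
  also have "\<dots> \<le> (\<Sum>i<m. (q i - q (Suc i)) * (K * real (Suc i)))"
    using q count by (intro sum_mono mult_left_mono) (auto simp del: of_nat_Suc)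
  also have "\<dots> = K * (\<Sum>i<m. (q i - q (Suc i)) * real (Suc i))"
    by (simp add: sum_distrib_left mult.left_commute)
  also have "\<dots> = K * (\<Sum>i<m. q i)"
    using \<open>q m = 0\<close> by (simp add: abel del: of_nat_Suc)
  finally show ?thesis .
qed


section \<open>The greedy policy\<close>

text \<open>Zero outside the universe, exactly as \<open>ActProb\<close> evaluates, so that the
  program compares gains.\<close>

definition gain :: "probing_instance \<Rightarrow> nat \<Rightarrow> real" where
  "gain I e = (if e \<in> universe I then act_prob I e else 0)"

text \<open>The non-element \<open>n_elems I\<close> has gain 0 and stands for ``none''; hence elements of
  probability 0 are never probed.\<close>

fun best_below :: "probing_instance \<Rightarrow> history \<Rightarrow> nat \<Rightarrow> nat" where
  "best_below I h 0 = n_elems I"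
| "best_below I h (Suc e) =
     (if may_probe I h e \<and> gain I (best_below I h e) < gain I e then e else best_below I h e)"

definition best :: "probing_instance \<Rightarrow> history \<Rightarrow> nat" where
  "best I h = best_below I h (n_elems I)"

definition greedy_policy :: "probing_instance \<Rightarrow> policy" where
  "greedy_policy I h = (if best I h < n_elems I then Some (best I h) else None)"

lemma gain_n_elems [simp]: "gain I (n_elems I) = 0"
  by (simp add: gain_def universe_def)

lemma best_below_cases: "best_below I h k = n_elems I \<or> may_probe I h (best_below I h k)"
  by (induction k) auto

lemma best_cases: "best I h = n_elems I \<or> may_probe I h (best I h)"
  unfolding best_def by (rule best_below_cases)

lemma gain_best_below: "may_probe I h e \<Longrightarrow> e < k \<Longrightarrow> gain I e \<le> gain I (best_below I h k)"
  by (induction k) (auto simp: less_Suc_eq)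

lemma gain_le_gain_best: "may_probe I h e \<Longrightarrow> gain I e \<le> gain I (best I h)"
  unfolding best_def by (rule gain_best_below) (auto simp: may_probe_def universe_def)

lemma feasible_greedy: "feasible_policy I (greedy_policy I)"
proof -
  have "may_probe I h e" if "greedy_policy I h = Some e" for h e
    using best_cases[of I h] that by (simp add: greedy_policy_def split: if_splits)
  then show ?thesis
    by (simp add: feasible_policy_def)
qed

section \<open>Comparison with another policy for fixed outcomes\<close>

lemma gain_nonneg: "valid_instance I \<Longrightarrow> 0 \<le> gain I e"
  by (auto simp: gain_def valid_instance_def)

text \<open>The thresholds \<open>q i\<close> are the gains of the successive greedy probes. In the
  factor, \<open>k\<close> pays for the outer system and 1 for the deadlines.\<close>

lemma greedy_weight_bound:
  assumes I: "valid_instance I" and k: "k_system k (universe I) (outer I)"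
    and h: "h = final_history I (greedy_policy I) \<omega>" and h': "feasible_history I h'"
    and T: "T = {e \<in> probed h'. e \<in> probed h \<or> insert e (chosen h) \<in> inner I}"
  shows "sum (gain I) T \<le> (k + 1) * sum (gain I) (probed h)"
proof (cases "h' = []")
  case True
  have "0 < k"
    using k by (simp add: k_system_def)
  then show ?thesis
    using True T gain_nonneg[OF I] by (auto intro!: mult_nonneg_nonneg sum_nonneg)
next
  case False
  define m where "m = length h"
  define q where "q i = gain I (best I (take i h))" for i
  have "0 < k"
    using k by (simp add: k_system_def)
  have fh: "feasible_history I h"
    unfolding h final_history_def by (rule feasible_run[OF feasible_greedy])
  have step: "best I (take j h) = fst (h ! j)" if "j < m" for j
    using run_policy_nth[of j "greedy_policy I" \<omega> "n_elems I"] that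
    by (auto simp: h final_history_def m_def greedy_policy_def split: if_splits)
  \<comment> \<open>The policy has stopped on \<open>h\<close>, so \<open>best\<close> is the dummy
    \<open>n_elems I\<close>, of gain 0.\<close>
  have "q m = 0"
    using policy_final_history[OF feasible_greedy, of I \<omega>] best_cases[of I h] unfolding h[symmetric]
    by (auto simp: q_def m_def greedy_policy_def may_probe_def universe_def split: if_splits)
  have antimono: "q j \<le> q i" if "i \<le> j" "j \<le> m" for i j
  proof (cases "best I (take j h) = n_elems I")
    case True
    then show ?thesis
      by (simp add: q_def gain_nonneg I)
  next
    case False
    then have "may_probe I (take i h) (best I (take j h))"
      using best_cases may_probe_take_antimono[OF I] that by (metis m_def)
    then show ?thesis
      unfolding q_def by (rule gain_le_gain_best)
  qed
  have sum_q: "(\<Sum>i<m. q i) = sum (gain I) (probed h)"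
  proof -
    have "distinct (map fst h)"
      using feasible_history_card_probed[OF fh] by (simp add: card_distinct probed_def)
    then have "sum (gain I) (probed h) = sum_list (map (gain I) (map fst h))"
      unfolding probed_def by (simp only: sum_list_distinct_conv_sum_set set_map)
    also have "\<dots> = (\<Sum>i<m. q i)"
      using step by (simp add: sum_list_sum_nth m_def atLeast0LessThan q_def)
    finally show ?thesis ..
  qed
  have "sum (gain I) T \<le> (k + 1) * (\<Sum>i<m. q i)"
  proof (rule sum_le_of_level_counts)
    fix i
    assume i: "i \<le> m"
    define G where "G = probed (take i h)"
    define D where "D = {e \<in> probed h'. deadline I e \<le> i}"
    \<comment> \<open>Elements of \<open>G\<close> are included at no cost, since
      \<open>k_system_card_le\<close> asks for blocking only on \<open>C - G\<close>.\<close>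
    define C where "C = {e \<in> probed h'. e \<in> G \<or> insert e G \<notin> outer I}"
    have "{e \<in> T. q i < gain I e} \<subseteq> D \<union> C"
    proof (rule subsetI, rule ccontr)
      fix e
      assume "e \<in> {e \<in> T. q i < gain I e}" and DC: "e \<notin> D \<union> C"
      then have e: "e \<in> T" "q i < gain I e" "e \<in> probed h'"
        by (auto simp: T)
      have "\<not> may_probe I (take i h) e"
        using gain_le_gain_best[of I "take i h" e] e by (auto simp: q_def)
      then have blocked: "insert e (chosen (take i h)) \<notin> inner I"
        using DC e i feasible_history_probed_subset[OF h']
        by (auto simp: may_probe_def D_def C_def G_def m_def)
      \<comment> \<open>Were \<open>e\<close> a greedy probe, its gain above \<open>q i\<close>
        would put it among the first \<open>i\<close>, hence into \<open>G\<close>.\<close>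
      have "e \<notin> probed h"
      proof
        assume "e \<in> probed h"
        then obtain j where j: "j < m" "e = fst (h ! j)"
          unfolding probed_def m_def by (metis (no_types, lifting) imageE in_set_conv_nth)
        have "gain I e = q j"
          using j step by (simp add: q_def)
        then have "j < i"
          using e antimono[of i j] j by force
        then have "e \<in> G"
          using j unfolding G_def probed_def m_def
          by (metis (no_types, lifting) image_eqI in_set_conv_nth length_take min_less_iff_conj nth_take)
        then show False
          using DC e by (auto simp: C_def)
      qed
      \<comment> \<open>The chosen set only grows, so an inner conflict after \<open>i\<close>
        probes persists to the end.\<close>
      moreover have "insert e (chosen h) \<notin> inner I"
      proof
        have "insert e (chosen (take i h)) \<subseteq> insert e (chosen h)"
          using chosen_take_mono[of i m h] i by (auto simp: m_def)
        moreover assume "insert e (chosen h) \<in> inner I"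
        ultimately show False
          using blocked inner_subset[OF I] by blast
      qed
      ultimately show False
        using e by (auto simp: T)
    qed
    moreover have "finite (D \<union> C)"
      by (auto simp: D_def C_def)
    ultimately have "card {e \<in> T. q i < gain I e} \<le> card D + card C"
      by (meson card_Un_le card_mono le_trans)
    moreover have "card D \<le> i"
      unfolding D_def by (rule feasible_history_card_early_deadlines[OF h'])
    moreover have "real (card C) \<le> k * real (card G)"
    proof (rule k_system_card_le[OF k])
      \<comment> \<open>Here the empty \<open>h'\<close> had to be excluded: \<open>outer I\<close>
        might be the empty family.\<close>
      have emp: "{} \<in> outer I"
        using feasible_history_outer_empty[OF h' I False] .
      show "G \<in> outer I"
        unfolding G_def by (intro feasible_history_outer feasible_history_take fh emp)
      have "probed h' \<in> outer I"
        by (intro feasible_history_outer h' emp)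
      then show "C \<in> outer I"
        by (rule outer_subset[OF I]) (auto simp: C_def)
    qed (auto simp: C_def)
    moreover have "card G = i"
      using feasible_history_card_probed[OF feasible_history_take[OF fh, of i]] i
      by (simp add: G_def m_def)
    ultimately show "real (card {e \<in> T. q i < gain I e}) \<le> (k + 1) * real i"
      by (simp add: algebra_simps)
  qed (use T \<open>0 < k\<close> \<open>q m = 0\<close> antimono in auto)
  then show ?thesis
    by (simp add: sum_q)
qed

lemma greedy_blocked_bound:
  assumes I: "valid_instance I" and k: "k_system k (universe I) (inner I)"
    and h: "feasible_history I h" and h': "feasible_history I h'"
    and T: "T = {e \<in> probed h'. e \<in> probed h \<or> insert e (chosen h) \<in> inner I}"
  shows "real (card (chosen h' - T)) \<le> k * real (card (chosen h))"
proof (cases "h' = []")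
  case True
  then show ?thesis
    using k by (simp add: k_system_def)
next
  case False
  then have emp: "{} \<in> inner I"
    using feasible_history_inner_empty[OF h' I] by blast
  show ?thesis
  proof (rule k_system_card_le[OF k])
    show "chosen h \<in> inner I"
      by (intro feasible_history_inner h I emp)
    have "chosen h' \<in> inner I"
      by (intro feasible_history_inner h' I emp)
    then show "chosen h' - T \<in> inner I"
      by (rule inner_subset[OF I]) auto
  qed (use T chosen_subset_probed in auto)
qed

text \<open>Linearity over elements: membership of \<open>e\<close> in \<open>T \<omega>\<close>
  ignores the outcome of \<open>e\<close>, so each member counts with weight
  \<open>act_prob I e\<close>. Applied below to \<open>T\<close> and to the set probed by
  greedy.\<close>

lemma expectation_card_active:
  assumes I: "valid_instance I"
    and sub: "\<And>\<omega>. T \<omega> \<subseteq> universe I"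
    and indep: "\<And>\<omega> e b. e \<in> T (\<omega> (e := b)) \<longleftrightarrow> e \<in> T \<omega>"
  shows "measure_pmf.expectation (activity I) (\<lambda>\<omega>. real (card {e \<in> T \<omega>. \<omega> e})) =
    measure_pmf.expectation (activity I) (\<lambda>\<omega>. sum (gain I) (T \<omega>))"
proof -
  have card: "real (card {e \<in> T \<omega>. \<omega> e}) = (\<Sum>e\<in>universe I. of_bool (e \<in> T \<omega>) * of_bool (\<omega> e))"
    for \<omega>
  proof -
    have "{e \<in> T \<omega>. \<omega> e} = universe I \<inter> {e. e \<in> T \<omega> \<and> \<omega> e}"
      using sub by auto
    moreover have "real (card (universe I \<inter> {e. e \<in> T \<omega> \<and> \<omega> e})) =
        (\<Sum>e\<in>universe I. of_bool (e \<in> T \<omega> \<and> \<omega> e))"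
      by (subst sum_of_bool_eq) auto
    ultimately show ?thesis
      by (simp only: of_bool_conj)
  qed
  have gain: "sum (gain I) (T \<omega>) = (\<Sum>e\<in>universe I. act_prob I e * of_bool (e \<in> T \<omega>))" for \<omega>
    using sub[of \<omega>] by (intro sum.mono_neutral_cong_left) (auto simp: gain_def)
  have "measure_pmf.expectation (activity I) (\<lambda>\<omega>. of_bool (e \<in> T \<omega>) * of_bool (\<omega> e)) =
      act_prob I e * measure_pmf.expectation (activity I) (\<lambda>\<omega>. of_bool (e \<in> T \<omega>))"
    if "e \<in> universe I" for e
    using I that indep by (intro expectation_activity_indep) (auto simp: valid_instance_def)
  then show ?thesis
    unfolding card gain
    by (simp add: Bochner_Integration.integral_sum del: sum_of_bool_mult_eq sum_mult_of_bool_eq)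
qed

lemma greedy_approximation:
  assumes I: "valid_instance I" and k_in: "k_system k_in (universe I) (inner I)"
    and k_out: "k_system k_out (universe I) (outer I)" and \<sigma>: "feasible_policy I \<sigma>"
  shows "expected_chosen I \<sigma> \<le> (k_in + k_out + 1) * expected_chosen I (greedy_policy I)"
proof -
  let ?E = "measure_pmf.expectation (activity I)"
  define h where "h \<omega> = final_history I (greedy_policy I) \<omega>" for \<omega>
  define h' where "h' \<omega> = final_history I \<sigma> \<omega>" for \<omega>
  define T where
    "T \<omega> = {e \<in> probed (h' \<omega>). e \<in> probed (h \<omega>) \<or> insert e (chosen (h \<omega>)) \<in> inner I}" for \<omega>
  have fh: "feasible_history I (h \<omega>)" "feasible_history I (h' \<omega>)" for \<omega>
    unfolding h_def h'_def final_history_def using feasible_run[OF feasible_greedy] feasible_run[OF \<sigma>]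
    by auto
  have chosen: "chosen (h \<omega>) = {e \<in> probed (h \<omega>). \<omega> e}" "chosen (h' \<omega>) = {e \<in> probed (h' \<omega>). \<omega> e}" for \<omega>
    unfolding h_def h'_def final_history_def by (rule chosen_run_policy)+
  have upd: "e \<in> probed (h (\<omega> (e := b))) \<longleftrightarrow> e \<in> probed (h \<omega>)"
    "e \<in> probed (h' (\<omega> (e := b))) \<longleftrightarrow> e \<in> probed (h' \<omega>)"
    "e \<notin> probed (h \<omega>) \<Longrightarrow> h (\<omega> (e := b)) = h \<omega>" for e \<omega> b
    unfolding h_def h'_def final_history_def
    by (rule probed_run_policy_upd probed_run_policy_upd run_policy_upd; assumption?)+
  have T_sub: "T \<omega> \<subseteq> universe I" for \<omega>
    using feasible_history_probed_subset[OF fh(2)] by (auto simp: T_def)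
  \<comment> \<open>If greedy probes \<open>e\<close>, only membership in the probed sets matters,
    and it ignores the outcome of \<open>e\<close>; otherwise the whole greedy history is
    unchanged.\<close>
  have T_upd: "e \<in> T (\<omega> (e := b)) \<longleftrightarrow> e \<in> T \<omega>" for e \<omega> b
    using upd[of e \<omega> b] by (auto simp: T_def)
  have "real (card (chosen (h' \<omega>))) \<le>
      real (card {e \<in> T \<omega>. \<omega> e}) + k_in * real (card (chosen (h \<omega>)))" for \<omega>
  proof -
    have "chosen (h' \<omega>) = {e \<in> T \<omega>. \<omega> e} \<union> (chosen (h' \<omega>) - T \<omega>)"
      using chosen(2)[of \<omega>] by (auto simp: T_def)
    then have "card (chosen (h' \<omega>)) \<le> card {e \<in> T \<omega>. \<omega> e} + card (chosen (h' \<omega>) - T \<omega>)"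
      using card_Un_le[of "{e \<in> T \<omega>. \<omega> e}" "chosen (h' \<omega>) - T \<omega>"] by simp
    then have "real (card (chosen (h' \<omega>))) \<le>
        real (card {e \<in> T \<omega>. \<omega> e}) + real (card (chosen (h' \<omega>) - T \<omega>))"
      by (simp only: of_nat_add[symmetric] of_nat_le_iff)
    also have "real (card (chosen (h' \<omega>) - T \<omega>)) \<le> k_in * real (card (chosen (h \<omega>)))"
      by (rule greedy_blocked_bound[OF I k_in fh T_def])
    finally show ?thesis
      by simp
  qed
  then have "expected_chosen I \<sigma> \<le>
      ?E (\<lambda>\<omega>. real (card {e \<in> T \<omega>. \<omega> e}) + k_in * real (card (chosen (h \<omega>))))"
    unfolding expected_chosen_def h'_def by (intro integral_mono) auto
  also have "\<dots> = ?E (\<lambda>\<omega>. sum (gain I) (T \<omega>)) + k_in * expected_chosen I (greedy_policy I)"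
    using expectation_card_active[OF I T_sub T_upd] by (simp add: expected_chosen_def h_def)
  also have "?E (\<lambda>\<omega>. sum (gain I) (T \<omega>)) \<le> ?E (\<lambda>\<omega>. (k_out + 1) * sum (gain I) (probed (h \<omega>)))"
    using greedy_weight_bound[OF I k_out h_def fh(2) T_def] by (intro integral_mono) auto
  \<comment> \<open>The active part of the set probed by greedy is its chosen set, so total gain
    turns back into expected cardinality.\<close>
  also have "\<dots> = (k_out + 1) * ?E (\<lambda>\<omega>. real (card {e \<in> probed (h \<omega>). \<omega> e}))"
    using expectation_card_active[OF I feasible_history_probed_subset[OF fh(1)] upd(1)] by simp
  also have "\<dots> = (k_out + 1) * expected_chosen I (greedy_policy I)"
    unfolding expected_chosen_def h_def[symmetric] chosen(1) ..
  finally show ?thesis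
    by (simp add: algebra_simps)
qed


section \<open>The greedy program\<close>

text \<open>A total-correctness triple with a time budget. A \<open>runs\<close> statement about the
  rest of the program can serve as postcondition, which is how sequences are handled.\<close>

definition runs ::
  "probing_instance \<Rightarrow> (nat \<Rightarrow> bool) \<Rightarrow> com \<Rightarrow> state \<Rightarrow> nat \<Rightarrow> (state \<Rightarrow> bool) \<Rightarrow> bool" where
  "runs I \<omega> c s B Q \<longleftrightarrow> (\<exists>T s'. exec I \<omega> c s T s' \<and> T \<le> B \<and> Q s')"

lemma runs_Skip: "Q s \<Longrightarrow> runs I \<omega> Skip s 1 Q"
  unfolding runs_def using exec.Skip by blast

lemma runs_Assign:
  "Q (s\<lparr>cells := (cells s)(aval I s a := aval I s b)\<rparr>) \<Longrightarrow> runs I \<omega> (Assign a b) s 1 Q"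
  unfolding runs_def using exec.Assign by blast

lemma runs_Probe:
  "Q (s\<lparr>cells := (cells s)(aval I s a := of_bool (\<omega> (aval I s b))),
        probes := probes s @ [(aval I s b, \<omega> (aval I s b))]\<rparr>) \<Longrightarrow> runs I \<omega> (Probe a b) s 1 Q"
  unfolding runs_def using exec.Probe by blast

lemma runs_Seq:
  "runs I \<omega> c1 s B1 (\<lambda>s1. runs I \<omega> c2 s1 B2 Q) \<Longrightarrow> runs I \<omega> (Seq c1 c2) s (B1 + B2) Q"
  unfolding runs_def by (meson add_mono exec.Seq)

text \<open>Adding the branch budgets, instead of taking the maximum, keeps every budget a sum that
  mirrors the program text.\<close>

lemma runs_If:
  assumes "bval I s b \<Longrightarrow> runs I \<omega> c1 s B1 Q" "\<not> bval I s b \<Longrightarrow> runs I \<omega> c2 s B2 Q"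
  shows "runs I \<omega> (If b c1 c2) s (1 + (B1 + B2)) Q"
proof (cases "bval I s b")
  case True
  then obtain T s' where "exec I \<omega> c1 s T s'" "T \<le> B1" "Q s'"
    using assms by (auto simp: runs_def)
  then show ?thesis
    using exec.IfTrue[OF True, of \<omega> c1 T s' c2] unfolding runs_def by (intro exI[of _ "1 + T"]) auto
next
  case False
  then obtain T s' where "exec I \<omega> c2 s T s'" "T \<le> B2" "Q s'"
    using assms by (auto simp: runs_def)
  then show ?thesis
    using exec.IfFalse[OF False, of \<omega> c2 T s' c1] unfolding runs_def by (intro exI[of _ "1 + T"]) auto
qed

lemma runs_mono: "runs I \<omega> c s B Q \<Longrightarrow> (\<And>s'. Q s' \<Longrightarrow> Q' s') \<Longrightarrow> runs I \<omega> c s B Q'"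
  unfolding runs_def by blast

text \<open>The invariant is indexed by the iteration number, with exactly \<open>k\<close>
  iterations; the final 1 pays for the failing test.\<close>

lemma runs_While:
  assumes step: "\<And>i s. i < k \<Longrightarrow> P i s \<Longrightarrow> bval I s b \<and> runs I \<omega> c s B (P (Suc i))"
    and stop: "\<And>s. P k s \<Longrightarrow> \<not> bval I s b"
    and init: "P 0 s"
  shows "runs I \<omega> (While b c) s (k * (1 + B) + 1) (P k)"
proof -
  have "runs I \<omega> (While b c) s (j * (1 + B) + 1) (P k)" if "P i s" "i + j = k" for i j s
    using that
  proof (induction j arbitrary: i s)
    case 0
    then show ?case
      using exec.WhileFalse[OF stop] unfolding runs_def by fastforce
  next
    case (Suc j)
    then have b: "bval I s b" and "runs I \<omega> c s B (P (Suc i))"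
      using step[of i s] by auto
    then obtain T1 s1 where 1: "exec I \<omega> c s T1 s1" "T1 \<le> B" "P (Suc i) s1"
      by (auto simp: runs_def)
    obtain T2 s2 where 2: "exec I \<omega> (While b c) s1 T2 s2" "T2 \<le> j * (1 + B) + 1" "P k s2"
      using Suc.IH[OF 1(3)] Suc.prems by (auto simp: runs_def)
    show ?case
      unfolding runs_def
      using exec.WhileTrue[OF b 1(1) 2(1)] 1 2 by (intro exI[of _ "1 + T1 + T2"] exI[of _ s2]) auto
  qed
  then show ?thesis
    using init by simp
qed

text \<open>Memory layout: cell 0 counts rounds, cell 1 counts probes, cell 2 is the current
  candidate and cell 3 the best candidate so far. The characteristic vectors of the probed
  and of the chosen set start at cells 4 and \<open>4 + n\<close>.\<close>

abbreviation round_var :: aexp where "round_var \<equiv> Cell (Const 0)"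
abbreviation count_var :: aexp where "count_var \<equiv> Cell (Const 1)"
abbreviation cand_var :: aexp where "cand_var \<equiv> Cell (Const 2)"
abbreviation best_var :: aexp where "best_var \<equiv> Cell (Const 3)"
abbreviation probed_base :: aexp where "probed_base \<equiv> Const 4"
abbreviation chosen_base :: aexp where "chosen_base \<equiv> Plus (Const 4) NumElems"

text \<open>Oracles read stored vectors, so the candidate is inserted into both for the query and
  then removed. Elements already probed are skipped, since removal would erase their
  records.\<close>

definition test_candidate :: com where
  "test_candidate =
     Seq (If (Less (Cell (Plus probed_base cand_var)) (Const 1))
       (Seq (Assign (Plus probed_base cand_var) (Const 1))
       (Seq (Assign (Plus chosen_base cand_var) (Const 1))
       (Seq (If (Conj (InOuter probed_base) (Conj (InInner chosen_base)
               (Conj (Less count_var (Deadline cand_var)) (RLess (ActProb best_var) (ActProb cand_var)))))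
             (Assign (Const 3) cand_var) Skip)
       (Seq (Assign (Plus probed_base cand_var) (Const 0))
            (Assign (Plus chosen_base cand_var) (Const 0))))))
       Skip)
     (Assign (Const 2) (Plus cand_var (Const 1)))"

definition find_best :: com where
  "find_best =
     Seq (Assign (Const 2) (Const 0))
    (Seq (Assign (Const 3) NumElems)
         (While (Less cand_var NumElems) test_candidate))"

text \<open>\<open>Probe\<close> writes the outcome straight into the chosen vector, which needs no
  further update.\<close>

definition probe_best :: com where
  "probe_best =
     Seq (If (Less best_var NumElems)
       (Seq (Probe (Plus chosen_base best_var) best_var)
       (Seq (Assign (Plus probed_base best_var) (Const 1))
            (Assign (Const 1) (Plus count_var (Const 1)))))
       Skip)
     (Assign (Const 0) (Plus round_var (Const 1)))"

text \<open>One round per step of \<open>final_history\<close>; rounds after the policy has stopped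
  make no probe.\<close>

definition greedy_program :: com where
  "greedy_program = While (Less round_var NumElems) (Seq find_best probe_best)"

text \<open>The round number \<open>r\<close> is separate from \<open>length h\<close>, since idle
  rounds advance only the former.\<close>

definition encodes :: "probing_instance \<Rightarrow> nat \<Rightarrow> history \<Rightarrow> state \<Rightarrow> bool" where
  "encodes I r h s \<longleftrightarrow> cells s 0 = r \<and> cells s 1 = length h \<and> probes s = h \<and>
     (\<forall>e<n_elems I. cells s (4 + e) = of_bool (e \<in> probed h)) \<and>
     (\<forall>e<n_elems I. cells s (4 + n_elems I + e) = of_bool (e \<in> chosen h))"

definition searching :: "probing_instance \<Rightarrow> nat \<Rightarrow> history \<Rightarrow> nat \<Rightarrow> state \<Rightarrow> bool" where
  "searching I r h i s \<longleftrightarrow> encodes I r h s \<and> cells s 2 = i \<and> cells s 3 = best_below I h i"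

section \<open>Correctness and running time of the program\<close>

lemma stored_set_eqI:
  assumes "\<And>e. e < n_elems I \<Longrightarrow> cells s (a + e) \<noteq> 0 \<longleftrightarrow> e \<in> A" "A \<subseteq> universe I"
  shows "stored_set I s a = A"
  using assms by (auto simp: stored_set_def universe_def)

text \<open>In \<open>s1\<close>, with both bits of \<open>i\<close> set, the test is the update
  condition of \<open>best_below\<close>. An unprobed \<open>i\<close> is also unchosen, so clearing
  the bits restores \<open>encodes\<close>.\<close>

lemma runs_test_candidate:
  assumes i: "i < n_elems I" and h: "feasible_history I h" and s: "searching I r h i s"
  shows "runs I \<omega> test_candidate s 10 (searching I r h (Suc i))"
proof -
  let ?n = "n_elems I"
  from s have c: "cells s 0 = r" "cells s (Suc 0) = length h" "probes s = h"
      "cells s 2 = i" "cells s 3 = best_below I h i"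
    and P: "\<And>e. e < ?n \<Longrightarrow> cells s (4 + e) = of_bool (e \<in> probed h)"
    and C: "\<And>e. e < ?n \<Longrightarrow> cells s (4 + ?n + e) = of_bool (e \<in> chosen h)"
    by (auto simp: searching_def encodes_def)
  have sub: "probed h \<subseteq> universe I" "chosen h \<subseteq> universe I" "chosen h \<subseteq> probed h"
    using feasible_history_probed_subset[OF h] chosen_subset_probed[of h] by auto
  define s1 where "s1 = s\<lparr>cells := (cells s)(4 + i := 1, 4 + ?n + i := 1)\<rparr>"
  have new: "stored_set I s1 4 = insert i (probed h)"
    "stored_set I s1 (4 + ?n) = insert i (chosen h)"
    using i sub P C by (intro stored_set_eqI; auto simp: s1_def universe_def)+
  let ?b = "Conj (InOuter probed_base) (Conj (InInner chosen_base)
    (Conj (Less count_var (Deadline cand_var)) (RLess (ActProb best_var) (ActProb cand_var))))"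
  have b: "bval I s1 ?b \<longleftrightarrow> may_probe I h i \<and> gain I (best_below I h i) < gain I i"
    if "i \<notin> probed h"
  proof -
    have "cells s1 (Suc 0) = length h" "cells s1 2 = i" "cells s1 3 = best_below I h i"
      by (simp_all add: s1_def c)
    then show ?thesis
      using i that new by (auto simp: may_probe_def gain_def universe_def Let_def)
  qed
  \<comment> \<open>The unsimplified sum, of value 10, follows the syntax tree so that the
    \<open>runs\<close> rules unify.\<close>
  have "runs I \<omega> test_candidate s
      ((1 + ((1 + (1 + ((1 + (1 + 1)) + (1 + 1)))) + 1)) + 1) (searching I r h (Suc i))"
    unfolding test_candidate_def
  proof (rule runs_Seq, rule runs_If)
    assume "bval I s (Less (Cell (Plus probed_base cand_var)) (Const 1))"
    then have np: "i \<notin> probed h"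
      using P[OF i] c by auto
    then have nc: "i \<notin> chosen h"
      using sub by auto
    show "runs I \<omega> (Seq (Assign (Plus probed_base cand_var) (Const 1))
       (Seq (Assign (Plus chosen_base cand_var) (Const 1))
       (Seq (If ?b (Assign (Const 3) cand_var) Skip)
       (Seq (Assign (Plus probed_base cand_var) (Const 0))
            (Assign (Plus chosen_base cand_var) (Const 0)))))) s (1 + (1 + ((1 + (1 + 1)) + (1 + 1))))
       (\<lambda>s'. runs I \<omega> (Assign (Const 2) (Plus cand_var (Const 1))) s' 1 (searching I r h (Suc i)))"
    proof (rule runs_Seq, rule runs_Assign, rule runs_Seq, rule runs_Assign, rule runs_Seq)
      let ?s = "s\<lparr>cells := (cells s)(aval I s (Plus probed_base cand_var) := aval I s (Const 1))\<rparr>"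
      have "?s\<lparr>cells := (cells ?s)(aval I ?s (Plus chosen_base cand_var) := aval I ?s (Const 1))\<rparr> = s1"
        by (simp add: s1_def c add.assoc)
      moreover have "runs I \<omega> (If ?b (Assign (Const 3) cand_var) Skip) s1 (1 + (1 + 1))
        (\<lambda>s2. runs I \<omega> (Seq (Assign (Plus probed_base cand_var) (Const 0))
            (Assign (Plus chosen_base cand_var) (Const 0))) s2 (1 + 1)
          (\<lambda>s'. runs I \<omega> (Assign (Const 2) (Plus cand_var (Const 1))) s' 1 (searching I r h (Suc i))))"
        by (intro runs_If runs_Seq runs_Assign runs_Skip; unfold b[OF np])
          (use i c P C np nc in \<open>auto simp: searching_def encodes_def s1_def\<close>)
      ultimately show "runs I \<omega> (If ?b (Assign (Const 3) cand_var) Skip)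
        (?s\<lparr>cells := (cells ?s)(aval I ?s (Plus chosen_base cand_var) := aval I ?s (Const 1))\<rparr>) (1 + (1 + 1))
        (\<lambda>s2. runs I \<omega> (Seq (Assign (Plus probed_base cand_var) (Const 0))
            (Assign (Plus chosen_base cand_var) (Const 0))) s2 (1 + 1)
          (\<lambda>s'. runs I \<omega> (Assign (Const 2) (Plus cand_var (Const 1))) s' 1 (searching I r h (Suc i))))"
        by (simp only:)
    qed
  next
    assume "\<not> bval I s (Less (Cell (Plus probed_base cand_var)) (Const 1))"
    \<comment> \<open>\<open>may_probe\<close> fails for a probed element, so
      \<open>best_below\<close> keeps its value as well.\<close>
    then have "i \<in> probed h"
      using P[OF i] c by (auto split: if_splits)
    then show "runs I \<omega> Skip s 1
       (\<lambda>s'. runs I \<omega> (Assign (Const 2) (Plus cand_var (Const 1))) s' 1 (searching I r h (Suc i)))"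
      by (intro runs_Skip runs_Assign) (use c P C in \<open>auto simp: searching_def encodes_def may_probe_def\<close>)
  qed
  then show ?thesis
    by (simp add: eval_nat_numeral)
qed

lemma runs_find_best:
  assumes h: "feasible_history I h" and s: "encodes I r h s"
  shows "runs I \<omega> find_best s (11 * n_elems I + 3)
    (\<lambda>s'. encodes I r h s' \<and> cells s' 3 = best I h)"
proof -
  let ?loop = "While (Less cand_var NumElems) test_candidate"
  have loop: "runs I \<omega> ?loop s0 (n_elems I * (1 + 10) + 1) (\<lambda>s'. encodes I r h s' \<and> cells s' 3 = best I h)"
    if "searching I r h 0 s0" for s0
  proof (rule runs_mono)
    show "runs I \<omega> ?loop s0 (n_elems I * (1 + 10) + 1) (searching I r h (n_elems I))"
    proof (rule runs_While)
      fix i s'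
      assume i: "i < n_elems I" and s': "searching I r h i s'"
      then have "bval I s' (Less cand_var NumElems)"
        by (simp add: searching_def)
      then show "bval I s' (Less cand_var NumElems) \<and> runs I \<omega> test_candidate s' 10 (searching I r h (Suc i))"
        using runs_test_candidate[OF i h s'] by blast
    qed (use that in \<open>auto simp: searching_def\<close>)
  qed (auto simp: searching_def best_def)
  \<comment> \<open>Two assignments, then one test and 10 units per candidate, and the failing
    test.\<close>
  have "runs I \<omega> find_best s (1 + (1 + (n_elems I * (1 + 10) + 1)))
    (\<lambda>s'. encodes I r h s' \<and> cells s' 3 = best I h)"
    unfolding find_best_def
    by (rule runs_Seq, rule runs_Assign, rule runs_Seq, rule runs_Assign, rule loop)
      (use s in \<open>simp add: searching_def encodes_def\<close>)
  moreover have "1 + (1 + (n_elems I * (1 + 10) + 1)) = 11 * n_elems I + 3"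
    by simp
  ultimately show ?thesis
    by (simp only:)
qed

lemma runs_probe_best:
  assumes h: "feasible_history I h" and s: "encodes I r h s" "cells s 3 = best I h"
  shows "runs I \<omega> probe_best s 6 (encodes I (Suc r)
    (case greedy_policy I h of None \<Rightarrow> h | Some e \<Rightarrow> h @ [(e, \<omega> e)]))"
proof -
  let ?n = "n_elems I"
  from s have c: "cells s 0 = r" "cells s (Suc 0) = length h" "probes s = h" "cells s 3 = best I h"
    and P: "\<And>e. e < ?n \<Longrightarrow> cells s (4 + e) = of_bool (e \<in> probed h)"
    and C: "\<And>e. e < ?n \<Longrightarrow> cells s (4 + ?n + e) = of_bool (e \<in> chosen h)"
    by (auto simp: encodes_def)
  \<comment> \<open>An inactive outcome writes 0 into the chosen vector, which is right because the
    element was not chosen before.\<close>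
  have "e \<notin> chosen h" if "best I h = e" "e < ?n" for e
    using that best_cases[of I h] chosen_subset_probed[of h] by (auto simp: may_probe_def)
  then have "runs I \<omega> probe_best s ((1 + ((1 + (1 + 1)) + 1)) + 1) (encodes I (Suc r)
    (case greedy_policy I h of None \<Rightarrow> h | Some e \<Rightarrow> h @ [(e, \<omega> e)]))"
    unfolding probe_best_def
    by (intro runs_Seq runs_If runs_Probe runs_Assign runs_Skip)
      (use c P C in \<open>auto simp: encodes_def greedy_policy_def\<close>)
  then show ?thesis
    by (simp add: eval_nat_numeral)
qed

lemma runs_greedy_program:
  "runs I \<omega> greedy_program initial_state (n_elems I * (11 * n_elems I + 10) + 1)
    (\<lambda>s. probes s = final_history I (greedy_policy I) \<omega>)"
proof -
  let ?n = "n_elems I" and ?h = "run_policy (greedy_policy I) \<omega>"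
  \<comment> \<open>The invariant matches \<open>r\<close> rounds with \<open>r\<close> steps of
    \<open>run_policy\<close>. A round costs 1 for the test, \<open>11 * ?n + 3\<close> for the
    search and 6 for the probe.\<close>
  have "runs I \<omega> greedy_program initial_state (?n * (1 + ((11 * ?n + 3) + 6)) + 1)
    (\<lambda>s. encodes I ?n (?h ?n) s)"
    unfolding greedy_program_def
  proof (rule runs_While)
    fix r s
    assume r: "r < ?n" and s: "encodes I r (?h r) s"
    have h: "feasible_history I (?h r)"
      by (rule feasible_run[OF feasible_greedy])
    have "runs I \<omega> probe_best s' 6 (encodes I (Suc r) (?h (Suc r)))"
      if "encodes I r (?h r) s' \<and> cells s' 3 = best I (?h r)" for s'
      using runs_probe_best[OF h] that by (simp add: Let_def)
    then have "runs I \<omega> (Seq find_best probe_best) s ((11 * ?n + 3) + 6) (encodes I (Suc r) (?h (Suc r)))"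
      by (intro runs_Seq runs_mono[OF runs_find_best[OF h s]])
    moreover have "bval I s (Less round_var NumElems)"
      using r s by (simp add: encodes_def)
    ultimately show "bval I s (Less round_var NumElems) \<and>
        runs I \<omega> (Seq find_best probe_best) s ((11 * ?n + 3) + 6) (encodes I (Suc r) (?h (Suc r)))"
      by blast
  qed (auto simp: encodes_def initial_state_def)
  then have "runs I \<omega> greedy_program initial_state (?n * (1 + ((11 * ?n + 3) + 6)) + 1)
    (\<lambda>s. probes s = final_history I (greedy_policy I) \<omega>)"
    by (rule runs_mono) (simp add: encodes_def final_history_def)
  moreover have "?n * (1 + ((11 * ?n + 3) + 6)) + 1 = ?n * (11 * ?n + 10) + 1"
    by simp
  ultimately show ?thesis
    by (simp only:)
qed

lemma greedy_program_implements:
  "implements_within greedy_program I (greedy_policy I) (poly [:1, 10, 11:] (input_size I))"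
proof -
  have n: "n_elems I \<le> input_size I"
    by (simp add: input_size_def)
  have "n_elems I * (11 * n_elems I + 10) + 1 \<le> input_size I * (11 * input_size I + 10) + 1"
    by (intro add_mono mult_mono n) auto
  also have "\<dots> = poly [:1, 10, 11:] (input_size I)"
    by (simp add: algebra_simps)
  finally have "n_elems I * (11 * n_elems I + 10) + 1 \<le> poly [:1, 10, 11:] (input_size I)" .
  then show ?thesis
    using runs_greedy_program[of I] unfolding implements_within_def runs_def
    by (meson order_trans)
qed


section \<open>The approximation guarantee\<close>

theorem theorem6:
  fixes k_in k_out :: real
  shows "\<exists>(c :: com) (q :: nat poly). \<forall>I :: probing_instance.
    valid_instance I \<and> k_system k_in (universe I) (inner I) \<and> k_system k_out (universe I) (outer I) \<longrightarrow>
    (\<exists>\<pi>. feasible_policy I \<pi> \<and>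
         implements_within c I \<pi> (poly q (input_size I)) \<and>
         (\<forall>\<sigma>. feasible_policy I \<sigma> \<longrightarrow>
            expected_chosen I \<pi> \<ge> 1 / (2 * (k_in + k_out + 1)) * expected_chosen I \<sigma>))"
proof (rule exI[of _ greedy_program], rule exI[of _ "[:1, 10, 11:]"], intro allI impI,
    rule exI[of _ "greedy_policy _"], intro conjI allI impI)
  fix I :: probing_instance and \<sigma> :: policy
  assume I: "valid_instance I \<and> k_system k_in (universe I) (inner I) \<and> k_system k_out (universe I) (outer I)"
    and \<sigma>: "feasible_policy I \<sigma>"
  define K where "K = k_in + k_out + 1"
  have "0 < K"
    using I by (simp add: k_system_def K_def)
  have nonneg: "0 \<le> expected_chosen I (greedy_policy I)"
    by (simp add: expected_chosen_def)
  have "expected_chosen I \<sigma> \<le> K * expected_chosen I (greedy_policy I)"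
    using greedy_approximation I \<sigma> unfolding K_def by blast
  \<comment> \<open>The bound with \<open>K\<close> is stronger than claimed; the factor 2 is given
    away here.\<close>
  also have "\<dots> \<le> 2 * K * expected_chosen I (greedy_policy I)"
    using \<open>0 < K\<close> nonneg by (intro mult_right_mono) auto
  finally show "1 / (2 * (k_in + k_out + 1)) * expected_chosen I \<sigma> \<le> expected_chosen I (greedy_policy I)"
    using \<open>0 < K\<close> unfolding K_def[symmetric] by (simp add: field_simps)
qed (rule feasible_greedy greedy_program_implements)+

end
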